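(* Let $R$ be a commutative ring with identity. Let $G$ be a distance well-defined graph on $n$ vertices with blocks $G_1,\dots,G_r$ ($r\ge 1$), where $G_i$ has $n_i\ge 2$ vertices. Let $D=(D_{uv})_{u,v\in V(G)}$ be a generalized distance matrix of $G$ over $R$. For each $1\le i\le r$ let $D_i$ be the principal submatrix of $D$ with rows and columns indexed by $V(G_i)$, and let $\lambda_i\in R$, let $\alpha_i,\beta_i$ be column vectors over $R$ indexed by $V(G_i)$, and let $L_i$ be a square matrix over $R$ indexed by $V(G_i)$. Define $\lambda=\sum_{i=1}^r\lambda_i$, column vectors $\alpha,\beta$ indexed by $V(G)$ by $$\alpha_v=\sum_{i\in \mathrm{Bl}_G(v)}(\alpha_i)_v-\mathrm{bi}_G(v)+1,\qquad \beta_v=\sum_{i\in \mathrm{Bl}_G(v)}(\beta_i)_v-\mathrm{bi}_G(v)+1,$$ and $L=\sum_{i=1}^r\hat L_i$, where $\hat L_i$ is the $V(G)\times V(G)$ matrix with $(\hat L_i)_{uv}=(L_i)_{uv}$ if $u,v\in V(G_i)$ and $(\hat L_i)_{uv}=0$ otherwise. (a) If for every $i$ we have $\alpha_i^T\mathbf{j}=1$, $L_i\mathbf{j}=\mathbf{0}$, $\alpha_i^TD_i=\lambda_i\mathbf{j}^T$ and $L_iD_i+I=\beta_i\mathbf{j}^T$, then $\alpha^T\mathbf{j}=1$, $L\mathbf{j}=\mathbf{0}$, $\alpha^TD=\lambda\mathbf{j}^T$ and $LD+I=\beta\mathbf{j}^T$. (b) If for every $i$ we have $\mathbf{j}^T\beta_i=1$,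 $\mathbf{j}^TL_i=\mathbf{0}$, $D_i\beta_i=\lambda_i\mathbf{j}$ and $D_iL_i+I=\mathbf{j}\alpha_i^T$, then $\mathbf{j}^T\beta=1$, $\mathbf{j}^TL=\mathbf{0}$, $D\beta=\lambda\mathbf{j}$ and $DL+I=\mathbf{j}\alpha^T$. In either case (a) or (b), if moreover $\lambda$ is invertible in $R$, then $D$ is invertible and $D^{-1}=-L+\lambda^{-1}\beta\alpha^T$.
   Context: A distance well-defined graph is a connected undirected graph, a strongly connected directed graph, or a strongly connected mixed graph (some edges undirected, some directed). Distances $\partial_G(u,v)$ are lengths of shortest (directed) paths. A cut vertex of $G$ is a vertex whose deletion disconnects $G$. A block of $G$ is a distance well-defined subgraph on at least two vertices with no cut vertices, maximal with respect to this property. A generalized distance matrix of $G$ over $R$ is a matrix $D=(D_{uv})_{u,v\in V(G)}$ with entries in $R$ such that $D_{uu}=0$ for all $u$, and whenever every shortest (directed) path from $u$ to $v$ passes through a cut vertex $x$, $D_{uv}=D_{ux}+D_{xv}$. For a vertex $v$, $\mathrm{Bl}_G(v)$ is the set of indices $k\in\{1,\dots,r\}$ with $v\in V(G_k)$, and $\mathrm{bi}_G(v)=|\mathrm{Bl}_G(v)|$. $\mathbf{j}$ denotes an all-ones column vector, $\mathbf{0}$ a zero matrix/vector and $I$ an identity matrix, each of appropriate size; $^T$ denotes transpose. *)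

theory Defs
  imports "Graph_Theory.Graph_Theory"
begin

section \<open>Mixed graphs\<close>

text \<open>
  Undirected graphs are the mixed graphs without arcs, directed graphs are the mixed graphs
  without undirected edges.
\<close>

record 'v mixed_graph =
  mverts :: "'v set"
  medges :: "'v set set"
  marcs :: "('v \<times> 'v) set"

definition wf_mixed_graph :: "'v mixed_graph \<Rightarrow> bool" where
  "wf_mixed_graph G \<longleftrightarrow>
     finite (mverts G) \<and>
     medges G \<subseteq> {{u, v} |u v. u \<in> mverts G \<and> v \<in> mverts G \<and> u \<noteq> v} \<and>
     marcs G \<subseteq> {(u, v). u \<in> mverts G \<and> v \<in> mverts G \<and> u \<noteq> v}"

definition mixed_subgraph :: "'v mixed_graph \<Rightarrow> 'v mixed_graph \<Rightarrow> bool" where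
  "mixed_subgraph H G \<longleftrightarrow>
     wf_mixed_graph H \<and> wf_mixed_graph G \<and>
     mverts H \<subseteq> mverts G \<and> medges H \<subseteq> medges G \<and> marcs H \<subseteq> marcs G"

definition mixed_del_vert :: "'v mixed_graph \<Rightarrow> 'v \<Rightarrow> 'v mixed_graph" where
  "mixed_del_vert G x =
     \<lparr> mverts = mverts G - {x},
       medges = {e \<in> medges G. x \<notin> e},
       marcs = {a \<in> marcs G. fst a \<noteq> x \<and> snd a \<noteq> x} \<rparr>"

text \<open>
  Directed walks in a mixed graph may use an undirected edge in both directions and an arc only
  in its own direction, so they are the walks of the following digraph.
\<close>

definition traversal :: "'v mixed_graph \<Rightarrow> ('v, 'v \<times> 'v) pre_digraph" where
  "traversal G = with_proj
     \<lparr> pverts = mverts G, parcs = marcs G \<union> {(u, v). {u, v} \<in> medges G} \<rparr>"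

definition distance_well_defined :: "'v mixed_graph \<Rightarrow> bool" where
  "distance_well_defined G \<longleftrightarrow> wf_mixed_graph G \<and> strongly_connected (traversal G)"

text \<open>
  Deleting a vertex disconnects the graph if the underlying undirected graph of the result is
  disconnected; \<^const>\<open>connected\<close> ignores orientations. Failure of strong connectivity is not
  enough: a directed cycle has no cut vertices. The empty graph, for which \<^const>\<open>connected\<close>
  is false, does not count as disconnected here.
\<close>

definition cut_vertex :: "'v mixed_graph \<Rightarrow> 'v \<Rightarrow> bool" where
  "cut_vertex G x \<longleftrightarrow>
     x \<in> mverts G \<and> mverts G - {x} \<noteq> {} \<and> \<not> connected (traversal (mixed_del_vert G x))"

definition nonseparable_subgraph :: "'v mixed_graph \<Rightarrow> 'v mixed_graph \<Rightarrow> bool" where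
  "nonseparable_subgraph G H \<longleftrightarrow>
     mixed_subgraph H G \<and> distance_well_defined H \<and> card (mverts H) \<ge> 2 \<and>
     (\<forall>x. \<not> cut_vertex H x)"

definition blocks :: "'v mixed_graph \<Rightarrow> 'v mixed_graph set" where
  "blocks G = {H. nonseparable_subgraph G H \<and>
     (\<forall>H'. nonseparable_subgraph G H' \<and> mixed_subgraph H H' \<longrightarrow> H' = H)}"

definition shortest_path :: "'v mixed_graph \<Rightarrow> 'v \<Rightarrow> ('v \<times> 'v) list \<Rightarrow> 'v \<Rightarrow> bool" where
  "shortest_path G u p v \<longleftrightarrow>
     pre_digraph.apath (traversal G) u p v \<and>
     (\<forall>q. pre_digraph.apath (traversal G) u q v \<longrightarrow> length p \<le> length q)"

section \<open>Matrices indexed by vertex sets\<close>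

text \<open>
  A vector or matrix indexed by a vertex set S is a function of one or two vertices of which only
  the values on S matter. In particular, the principal submatrix of D with rows and columns in
  S is D itself, regarded as indexed by S.
\<close>

definition generalized_distance_matrix ::
  "'v mixed_graph \<Rightarrow> ('v \<Rightarrow> 'v \<Rightarrow> 'r :: comm_ring_1) \<Rightarrow> bool" where
  "generalized_distance_matrix G D \<longleftrightarrow>
     (\<forall>u \<in> mverts G. D u u = 0) \<and>
     (\<forall>u \<in> mverts G. \<forall>v \<in> mverts G. \<forall>x. cut_vertex G x \<longrightarrow>
        (\<forall>p. shortest_path G u p v \<longrightarrow> x \<in> set (pre_digraph.awalk_verts (traversal G) u p)) \<longrightarrow>
        D u v = D u x + D x v)"

text \<open>
  The conjuncts are the entries of
  $\alpha^T \mathbf{j} = 1$, $L \mathbf{j} = \mathbf{0}$, $\alpha^T D = \lambda \mathbf{j}^T$ and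
  $L D + I = \beta \mathbf{j}^T$.
\<close>

definition left_conditions ::
  "'v set \<Rightarrow> ('v \<Rightarrow> 'v \<Rightarrow> 'r :: comm_ring_1) \<Rightarrow> 'r \<Rightarrow> ('v \<Rightarrow> 'r) \<Rightarrow> ('v \<Rightarrow> 'r) \<Rightarrow> ('v \<Rightarrow> 'v \<Rightarrow> 'r) \<Rightarrow> bool"
where
  "left_conditions S D lam \<alpha> \<beta> L \<longleftrightarrow>
     (\<Sum>v\<in>S. \<alpha> v) = 1 \<and>
     (\<forall>u\<in>S. (\<Sum>v\<in>S. L u v) = 0) \<and>
     (\<forall>v\<in>S. (\<Sum>u\<in>S. \<alpha> u * D u v) = lam) \<and>
     (\<forall>u\<in>S. \<forall>v\<in>S. (\<Sum>w\<in>S. L u w * D w v) + (if u = v then 1 else 0) = \<beta> u)"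

text \<open>
  The conjuncts are the entries of
  $\mathbf{j}^T \beta = 1$, $\mathbf{j}^T L = \mathbf{0}$, $D \beta = \lambda \mathbf{j}$ and
  $D L + I = \mathbf{j} \alpha^T$.
\<close>

definition right_conditions ::
  "'v set \<Rightarrow> ('v \<Rightarrow> 'v \<Rightarrow> 'r :: comm_ring_1) \<Rightarrow> 'r \<Rightarrow> ('v \<Rightarrow> 'r) \<Rightarrow> ('v \<Rightarrow> 'r) \<Rightarrow> ('v \<Rightarrow> 'v \<Rightarrow> 'r) \<Rightarrow> bool"
where
  "right_conditions S D lam \<alpha> \<beta> L \<longleftrightarrow>
     (\<Sum>v\<in>S. \<beta> v) = 1 \<and>
     (\<forall>v\<in>S. (\<Sum>u\<in>S. L u v) = 0) \<and>
     (\<forall>u\<in>S. (\<Sum>v\<in>S. D u v * \<beta> v) = lam) \<and>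
     (\<forall>u\<in>S. \<forall>v\<in>S. (\<Sum>w\<in>S. D u w * L w v) + (if u = v then 1 else 0) = \<alpha> v)"

definition is_inverse_matrix ::
  "'v set \<Rightarrow> ('v \<Rightarrow> 'v \<Rightarrow> 'r :: comm_ring_1) \<Rightarrow> ('v \<Rightarrow> 'v \<Rightarrow> 'r) \<Rightarrow> bool" where
  "is_inverse_matrix S A B \<longleftrightarrow>
     (\<forall>u\<in>S. \<forall>v\<in>S. (\<Sum>w\<in>S. A u w * B w v) = (if u = v then 1 else 0)) \<and>
     (\<forall>u\<in>S. \<forall>v\<in>S. (\<Sum>w\<in>S. B u w * A w v) = (if u = v then 1 else 0))"

section \<open>Combining block data\<close>

definition block_indices :: "nat \<Rightarrow> (nat \<Rightarrow> 'v mixed_graph) \<Rightarrow> 'v \<Rightarrow> nat set" where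
  "block_indices r Gs v = {k \<in> {1..r}. v \<in> mverts (Gs k)}"

definition combine_vectors ::
  "nat \<Rightarrow> (nat \<Rightarrow> 'v mixed_graph) \<Rightarrow> (nat \<Rightarrow> 'v \<Rightarrow> 'r :: comm_ring_1) \<Rightarrow> 'v \<Rightarrow> 'r" where
  "combine_vectors r Gs as v =
     (\<Sum>i\<in>block_indices r Gs v. as i v) - of_nat (card (block_indices r Gs v)) + 1"

definition combine_matrices ::
  "nat \<Rightarrow> (nat \<Rightarrow> 'v mixed_graph) \<Rightarrow> (nat \<Rightarrow> 'v \<Rightarrow> 'v \<Rightarrow> 'r :: comm_ring_1) \<Rightarrow> 'v \<Rightarrow> 'v \<Rightarrow> 'r" where
  "combine_matrices r Gs Ls u v =
     (\<Sum>i = 1..r. if u \<in> mverts (Gs i) \<and> v \<in> mverts (Gs i) then Ls i u v else 0)"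

end

(*
  A maximal vertex set that no vertex x separates (a "maximal inseparable" set) attaches every vertex
  v of the graph through a single gate: the first vertex of the set met on any walk from v. Sending
  v to its gate retracts the graph onto the set; this shows that the blocks are exactly the subgraphs
  induced by these sets (strong connectivity included), and that D is additive through gates.

  For u \<noteq> v, exactly one block containing u has a gate for v other than u, namely the one towards v.
  This count is the only combinatorial input: it turns the terms bi(v) - 1 into a sum over gates and so
  yields all four identities of (a). Part (b) is (a) for the transposed data, and a one-sided inverse
  over a commutative ring is two-sided by the adjugate.
*)
theory Submission
  imports Defs "Jordan_Normal_Form.Determinant"
begin

section \<open>One-sided inverses over a commutative ring\<close>

section \<open>Matrix algebra\<close>

text \<open>If BA is the identity, \<open>det B\<close> inverts \<open>det A\<close>, so the
  adjugate of A scaled by \<open>det B\<close> is a right inverse C of A, and B = B(AC) = C. An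
  enumeration of \<open>S\<close> moves the argument to library matrices.\<close>

lemma left_inverse_imp_right_inverse:
  fixes A B :: "'v \<Rightarrow> 'v \<Rightarrow> 'r :: comm_ring_1"
  assumes fin: "finite S"
    and BA: "\<And>u v. u \<in> S \<Longrightarrow> v \<in> S \<Longrightarrow> (\<Sum>w\<in>S. B u w * A w v) = (if u = v then 1 else 0)"
    and uv: "u \<in> S" "v \<in> S"
  shows "(\<Sum>w\<in>S. A u w * B w v) = (if u = v then 1 else 0)"
proof -
  define n where "n = card S"
  obtain f where f: "bij_betw f {0..<n} S"
    using ex_bij_betw_nat_finite[OF fin] unfolding n_def by blast
  define M :: "('v \<Rightarrow> 'v \<Rightarrow> 'r) \<Rightarrow> 'r mat" where "M = (\<lambda>X. mat n n (\<lambda>(i, j). X (f i) (f j)))"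
  have carr [simp]: "M X \<in> carrier_mat n n" for X
    by (simp add: M_def)
  have entry: "(M X * M Y) $$ (i, j) = (\<Sum>w\<in>S. X (f i) w * Y w (f j))" if "i < n" "j < n" for X Y i j
    using that by (simp add: M_def scalar_prod_def sum.reindex_bij_betw[OF f, symmetric])
  have f_in: "f i \<in> S" if "i < n" for i
    using that bij_betwE[OF f] by simp
  have f_eq: "f i = f j \<longleftrightarrow> i = j" if "i < n" "j < n" for i j
    using that bij_betw_imp_inj_on[OF f] by (auto simp: inj_on_def)
  have "M B * M A = 1\<^sub>m n"
    by (rule eq_matI) (auto simp: entry BA f_in f_eq simp del: index_mult_mat(1), simp_all add: M_def)
  then have det: "det (M B) * det (M A) = 1"
    using det_mult[of "M B" n "M A"] by simp
  let ?C = "det (M B) \<cdot>\<^sub>m adj_mat (M A)"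
  have C: "?C \<in> carrier_mat n n"
    using adj_mat(1)[OF carr] by simp
  have AC: "M A * ?C = 1\<^sub>m n"
    using adj_mat(1,2)[OF carr, of A] det by (auto simp: mult_smult_distrib[OF carr])
  have "M B = (M B * M A) * ?C"
    using assoc_mult_mat[OF carr carr C, of B A] AC by (simp add: right_mult_one_mat[OF carr])
  also have "\<dots> = ?C"
    using \<open>M B * M A = 1\<^sub>m n\<close> left_mult_one_mat[OF C] by simp
  finally have "M A * M B = 1\<^sub>m n"
    using AC by simp
  moreover obtain i j where ij: "i < n" "j < n" "u = f i" "v = f j"
    using uv f unfolding bij_betw_def by auto
  ultimately show ?thesis
    using entry[of i j A B] f_eq by simp
qed

section \<open>Algebra: the global identities and the inverse, from abstract gate data\<close>

section \<open>Combining data along gates\<close>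

text \<open>The interface between graph and algebra: \<open>S i\<close> is the vertex set of a
  block, and \<open>gate i v\<close> the vertex through which \<open>v\<close> is attached to it. By
  \<open>ex1_other_gate\<close>, exactly one block at \<open>u\<close> leads towards
  \<open>v\<close>.\<close>

locale gated_family =
  fixes V :: "'v set" and I :: "'i set" and S :: "'i \<Rightarrow> 'v set" and gate :: "'i \<Rightarrow> 'v \<Rightarrow> 'v"
  assumes finite_V: "finite V" and V_nonempty: "V \<noteq> {}" and finite_I: "finite I"
    and S_subset: "i \<in> I \<Longrightarrow> S i \<subseteq> V"
    and gate_in: "i \<in> I \<Longrightarrow> v \<in> V \<Longrightarrow> gate i v \<in> S i"
    and gate_self: "i \<in> I \<Longrightarrow> v \<in> S i \<Longrightarrow> gate i v = v"
    and ex1_other_gate: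
      "u \<in> V \<Longrightarrow> v \<in> V \<Longrightarrow> u \<noteq> v \<Longrightarrow> \<exists>!i. i \<in> I \<and> u \<in> S i \<and> gate i v \<noteq> u"
begin

lemma finite_S: "i \<in> I \<Longrightarrow> finite (S i)"
  using S_subset finite_V finite_subset by blast

text \<open>For \<open>u = v\<close> no block at \<open>u\<close> has a gate for \<open>v\<close>
  other than \<open>u\<close>; otherwise exactly one does. Hence bi(u) - 1 counts the blocks in
  which \<open>u\<close> is the gate for \<open>v\<close>, less 1 if \<open>u = v\<close>.\<close>

lemma card_gate:
  assumes u: "u \<in> V" and v: "v \<in> V"
  shows "card {i \<in> I. u \<in> S i} =
    card {i \<in> I. u \<in> S i \<and> gate i v = u} + (if u = v then 0 else 1)"
proof (cases "u = v")
  case True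
  then have "{i \<in> I. u \<in> S i} = {i \<in> I. u \<in> S i \<and> gate i v = u}"
    using gate_self by auto
  then show ?thesis using True by simp
next
  case False
  from ex1_other_gate[OF u v False] obtain k where
    k: "k \<in> I" "u \<in> S k" "gate k v \<noteq> u" and uniq: "\<And>i. i \<in> I \<and> u \<in> S i \<and> gate i v \<noteq> u \<Longrightarrow> i = k"
    by (elim ex1E) blast
  have "{i \<in> I. u \<in> S i} = insert k {i \<in> I. u \<in> S i \<and> gate i v = u}"
    using k uniq by blast
  then show ?thesis
    using False k finite_I by simp
qed

lemma sum_over_members:
  "(\<Sum>v\<in>V. \<Sum>i\<in>{i \<in> I. v \<in> S i}. f i v) = (\<Sum>i\<in>I. \<Sum>v\<in>S i. f i v)"
proof -
  have "(\<Sum>v\<in>V. \<Sum>i\<in>{i \<in> I. v \<in> S i}. f i v) = (\<Sum>i\<in>I. \<Sum>v\<in>{v \<in> V. v \<in> S i}. f i v)"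
    by (rule sum.swap_restrict[OF finite_V finite_I])
  also have "\<dots> = (\<Sum>i\<in>I. \<Sum>v\<in>S i. f i v)"
    using S_subset by (intro sum.cong refl) auto
  finally show ?thesis .
qed

text \<open>After rewriting bi(v) - 1 by \<open>card_gate\<close> and swapping sums, each block
  contributes \<open>h\<close> at its single gate for \<open>w\<close>. The choice of
  \<open>w\<close> is free, which the applications exploit.\<close>

lemma sum_over_gates:
  fixes h :: "'v \<Rightarrow> 'r :: comm_ring_1"
  assumes w: "w \<in> V"
  shows "(\<Sum>v\<in>V. (of_nat (card {i \<in> I. v \<in> S i}) - 1) * h v) = (\<Sum>i\<in>I. h (gate i w)) - h w"
proof -
  have "(\<Sum>v\<in>V. (of_nat (card {i \<in> I. v \<in> S i}) - 1) * h v) =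
     (\<Sum>v\<in>V. (\<Sum>i\<in>{i \<in> I. v \<in> S i}. if gate i w = v then h v else 0) - (if v = w then h v else 0))"
  proof (rule sum.cong[OF refl])
    fix v assume "v \<in> V"
    have "(\<Sum>i\<in>{i \<in> I. v \<in> S i}. if gate i w = v then h v else 0) =
        (\<Sum>i\<in>{i \<in> I. v \<in> S i \<and> gate i w = v}. h v)"
      using finite_I by (intro sum.mono_neutral_cong_right) auto
    also have "\<dots> = of_nat (card {i \<in> I. v \<in> S i \<and> gate i w = v}) * h v"
      by simp
    finally show "(of_nat (card {i \<in> I. v \<in> S i}) - 1) * h v =
       (\<Sum>i\<in>{i \<in> I. v \<in> S i}. if gate i w = v then h v else 0) - (if v = w then h v else 0)"
      using card_gate[OF \<open>v \<in> V\<close> w] by (simp add: algebra_simps)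
  qed
  also have "\<dots> = (\<Sum>i\<in>I. \<Sum>v\<in>S i. if gate i w = v then h v else 0) - h w"
    using w finite_V by (simp add: sum_subtractf sum_over_members)
  also have "(\<Sum>i\<in>I. \<Sum>v\<in>S i. if gate i w = v then h v else 0) = (\<Sum>i\<in>I. h (gate i w))"
    using gate_in[OF _ w] finite_S by (intro sum.cong refl) simp
  finally show ?thesis .
qed

text \<open>Within block \<open>i\<close>, column \<open>v\<close> of \<open>D\<close> is column
  \<open>gate i v\<close> plus the constant \<open>D (gate i v) v\<close>. Weighted by
  \<open>\<alpha>s i\<close>, of total 1, this constant is cancelled by the gate terms coming from
  bi - 1; weighted by a row of \<open>Ls i\<close>, of total 0, it vanishes.\<close>

lemma left_conditions_combine:
  fixes D :: "'v \<Rightarrow> 'v \<Rightarrow> 'r :: comm_ring_1"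
  assumes D_diag: "\<And>v. v \<in> V \<Longrightarrow> D v v = 0"
    and D_gate: "\<And>i u v. i \<in> I \<Longrightarrow> u \<in> S i \<Longrightarrow> v \<in> V \<Longrightarrow> D u v = D u (gate i v) + D (gate i v) v"
    and \<alpha>: "\<And>v. v \<in> V \<Longrightarrow> \<alpha> v = (\<Sum>i\<in>{i \<in> I. v \<in> S i}. \<alpha>s i v) - of_nat (card {i \<in> I. v \<in> S i}) + 1"
    and \<beta>: "\<And>v. v \<in> V \<Longrightarrow> \<beta> v = (\<Sum>i\<in>{i \<in> I. v \<in> S i}. \<beta>s i v) - of_nat (card {i \<in> I. v \<in> S i}) + 1"
    and L: "\<And>u v. u \<in> V \<Longrightarrow> v \<in> V \<Longrightarrow> L u v = (\<Sum>i\<in>I. if u \<in> S i \<and> v \<in> S i then Ls i u v else 0)"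
    and left: "\<And>i. i \<in> I \<Longrightarrow> left_conditions (S i) D (lams i) (\<alpha>s i) (\<beta>s i) (Ls i)"
  shows "left_conditions V D (\<Sum>i\<in>I. lams i) \<alpha> \<beta> L"
proof -
  have \<alpha>s_sum: "(\<Sum>v\<in>S i. \<alpha>s i v) = 1" if "i \<in> I" for i
    using left[OF that] by (simp add: left_conditions_def)
  have Ls_sum: "(\<Sum>v\<in>S i. Ls i u v) = 0" if "i \<in> I" "u \<in> S i" for i u
    using left[OF that(1)] that by (simp add: left_conditions_def)
  have \<alpha>sD: "(\<Sum>u\<in>S i. \<alpha>s i u * D u v) = lams i" if "i \<in> I" "v \<in> S i" for i v
    using left[OF that(1)] that by (simp add: left_conditions_def)
  have LsD: "(\<Sum>w\<in>S i. Ls i u w * D w v) = \<beta>s i u - (if u = v then 1 else 0)"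
    if "i \<in> I" "u \<in> S i" "v \<in> S i" for i u v
    using left[OF that(1)] that unfolding left_conditions_def by (simp add: eq_diff_eq)

  \<comment> \<open>The correction by bi(v) - 1 in \<open>\<alpha>\<close> becomes a subtraction of
    \<open>h\<close> at the gates. For \<open>\<alpha>\<close> times \<open>D\<close>,
    \<open>w\<close> will be the column index, so that \<open>h w\<close> is a diagonal entry of
    \<open>D\<close>.\<close>
  have \<alpha>_pairing: "(\<Sum>v\<in>V. \<alpha> v * h v) = (\<Sum>i\<in>I. (\<Sum>v\<in>S i. \<alpha>s i v * h v) - h (gate i w)) + h w"
    if w: "w \<in> V" for h w
  proof -
    have "(\<Sum>v\<in>V. \<alpha> v * h v) =
      (\<Sum>v\<in>V. (\<Sum>i\<in>{i \<in> I. v \<in> S i}. \<alpha>s i v * h v) - (of_nat (card {i \<in> I. v \<in> S i}) - 1) * h v)"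
      by (intro sum.cong refl) (simp add: \<alpha> sum_distrib_left sum_distrib_right algebra_simps)
    then show ?thesis
      by (simp add: sum_subtractf sum_over_members sum_over_gates[OF w])
  qed
  have L_pairing: "(\<Sum>w\<in>V. L u w * h w) = (\<Sum>i\<in>{i \<in> I. u \<in> S i}. \<Sum>w\<in>S i. Ls i u w * h w)"
    if u: "u \<in> V" for h u
  proof -
    have "L u w * h w = (\<Sum>i\<in>{i \<in> I. w \<in> S i}. if u \<in> S i then Ls i u w * h w else 0)" if "w \<in> V" for w
      using finite_I
      by (auto simp: L[OF u that] sum_distrib_right intro!: sum.mono_neutral_cong_right split: if_splits)
    then have "(\<Sum>w\<in>V. L u w * h w) = (\<Sum>i\<in>I. \<Sum>w\<in>S i. if u \<in> S i then Ls i u w * h w else 0)"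
      by (simp add: sum_over_members)
    also have "\<dots> = (\<Sum>i\<in>{i \<in> I. u \<in> S i}. \<Sum>w\<in>S i. Ls i u w * h w)"
      using finite_I by (intro sum.mono_neutral_cong_right) (auto simp: finite_S)
    finally show ?thesis .
  qed

  obtain w0 where w0: "w0 \<in> V" using V_nonempty by blast
  \<comment> \<open>With \<open>h\<close> constantly 1, each block contributes 1 - 1 and only
    \<open>h w0\<close> remains.\<close>
  have "(\<Sum>v\<in>V. \<alpha> v) = 1"
    using \<alpha>_pairing[OF w0, of "\<lambda>_. 1"] \<alpha>s_sum by simp
  moreover have "(\<Sum>v\<in>V. L u v) = 0" if "u \<in> V" for u
    using L_pairing[OF that, of "\<lambda>_. 1"] Ls_sum by simp
  moreover have "(\<Sum>u\<in>V. \<alpha> u * D u v) = (\<Sum>i\<in>I. lams i)" if v: "v \<in> V" for v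
  proof -
    have "(\<Sum>u\<in>S i. \<alpha>s i u * D u v) - D (gate i v) v = lams i" if i: "i \<in> I" for i
    proof -
      have "(\<Sum>u\<in>S i. \<alpha>s i u * D u v) =
          (\<Sum>u\<in>S i. \<alpha>s i u * D u (gate i v)) + (\<Sum>u\<in>S i. \<alpha>s i u) * D (gate i v) v"
        by (simp add: D_gate[OF i _ v] distrib_left sum.distrib sum_distrib_right)
      then show ?thesis
        by (simp add: \<alpha>sD[OF i gate_in[OF i v]] \<alpha>s_sum[OF i])
    qed
    then show ?thesis
      using \<alpha>_pairing[OF v, of "\<lambda>u. D u v"] D_diag[OF v] by simp
  qed
  moreover have "(\<Sum>w\<in>V. L u w * D w v) + (if u = v then 1 else 0) = \<beta> u" if u: "u \<in> V" and v: "v \<in> V" for u v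
  proof -
    have "(\<Sum>w\<in>S i. Ls i u w * D w v) = \<beta>s i u - (if gate i v = u then 1 else 0)"
      if i: "i \<in> I" "u \<in> S i" for i
    proof -
      have "(\<Sum>w\<in>S i. Ls i u w * D w v) =
          (\<Sum>w\<in>S i. Ls i u w * D w (gate i v)) + (\<Sum>w\<in>S i. Ls i u w) * D (gate i v) v"
        by (simp add: D_gate[OF i(1) _ v] distrib_left sum.distrib sum_distrib_right)
      then show ?thesis
        by (simp add: LsD[OF i gate_in[OF i(1) v]] Ls_sum[OF i] eq_commute)
    qed
    then have "(\<Sum>w\<in>V. L u w * D w v) =
        (\<Sum>i\<in>{i \<in> I. u \<in> S i}. \<beta>s i u) - (\<Sum>i\<in>{i \<in> I. u \<in> S i}. if gate i v = u then 1 else 0)"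
      by (simp add: L_pairing[OF u] sum_subtractf)
    \<comment> \<open>By \<open>card_gate\<close> this count is bi(u) - 1, plus 1 if
      \<open>u = v\<close>: the correction in \<open>\<beta>\<close> and the entry of the identity
      matrix.\<close>
    also have "(\<Sum>i\<in>{i \<in> I. u \<in> S i}. if gate i v = u then 1 else (0 :: 'r)) =
        (\<Sum>i\<in>{i \<in> I. u \<in> S i \<and> gate i v = u}. 1)"
      using finite_I by (intro sum.mono_neutral_cong_right) auto
    finally show ?thesis
      using card_gate[OF u v] by (simp add: \<beta>[OF u])
  qed
  ultimately show ?thesis
    unfolding left_conditions_def by blast
qed

end

text \<open>Products commute, so transposition turns right conditions into left ones, with
  \<open>\<alpha>\<close> and \<open>\<beta>\<close> trading roles.\<close>

lemma right_conditions_transpose: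
  fixes D L :: "'v \<Rightarrow> 'v \<Rightarrow> 'r :: comm_ring_1"
  shows "right_conditions S D lam \<alpha> \<beta> L \<longleftrightarrow>
    left_conditions S (\<lambda>u v. D v u) lam \<beta> \<alpha> (\<lambda>u v. L v u)"
proof -
  have 1: "(\<Sum>v\<in>S. D u v * \<beta> v) = (\<Sum>v\<in>S. \<beta> v * D u v)" for u
    by (simp add: mult.commute)
  have 2: "(\<Sum>w\<in>S. D u w * L w v) + (if u = v then 1 else 0) =
      (\<Sum>w\<in>S. L w v * D u w) + (if v = u then 1 else 0)" for u v
    by (cases "u = v") (simp_all add: mult.commute)
  show ?thesis
    unfolding right_conditions_def left_conditions_def 1 2 by blast
qed

lemma is_inverse_matrix_transpose:
  fixes A B :: "'v \<Rightarrow> 'v \<Rightarrow> 'r :: comm_ring_1"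
  shows "is_inverse_matrix S (\<lambda>u v. A v u) (\<lambda>u v. B v u) \<longleftrightarrow> is_inverse_matrix S A B"
proof -
  have "(\<Sum>w\<in>S. X w u * Y v w) = (if u = v then 1 else 0) \<longleftrightarrow>
      (\<Sum>w\<in>S. Y v w * X w u) = (if v = u then 1 else 0)" for X Y :: "'v \<Rightarrow> 'v \<Rightarrow> 'r" and u v
    by (cases "u = v") (simp_all add: mult.commute)
  from this[of A _ B] this[of B _ A] show ?thesis
    unfolding is_inverse_matrix_def by blast
qed

text \<open>In the product with \<open>D\<close>, the part \<open>- L\<close> gives
  \<open>I - \<beta> j^T\<close> and the rank-one part gives \<open>\<beta> j^T\<close>, because
  \<open>\<alpha>^T D = lam j^T\<close>. The other product follows by
  \<open>left_inverse_imp_right_inverse\<close>.\<close>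

lemma left_conditions_inverse:
  assumes fin: "finite S" and left: "left_conditions S D lam \<alpha> \<beta> L" and inv: "lam * lam_inv = 1"
  shows "is_inverse_matrix S D (\<lambda>u v. - L u v + lam_inv * (\<beta> u * \<alpha> v))"
proof -
  let ?B = "\<lambda>u v. - L u v + lam_inv * (\<beta> u * \<alpha> v)"
  have BD: "(\<Sum>w\<in>S. ?B u w * D w v) = (if u = v then 1 else 0)" if "u \<in> S" "v \<in> S" for u v
  proof -
    have "(\<Sum>w\<in>S. ?B u w * D w v) =
        - (\<Sum>w\<in>S. L u w * D w v) + lam_inv * \<beta> u * (\<Sum>w\<in>S. \<alpha> w * D w v)"
      by (simp add: sum_distrib_left sum_subtractf algebra_simps)
    also have "(\<Sum>w\<in>S. \<alpha> w * D w v) = lam"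
      using left that by (simp add: left_conditions_def)
    also have "(\<Sum>w\<in>S. L u w * D w v) = \<beta> u - (if u = v then 1 else 0)"
      using left that unfolding left_conditions_def by (simp add: eq_diff_eq)
    also have "lam_inv * \<beta> u * lam = \<beta> u"
      using inv by (metis mult.assoc mult.commute mult_1)
    finally show ?thesis by simp
  qed
  show ?thesis
    unfolding is_inverse_matrix_def
    using BD left_inverse_imp_right_inverse[OF fin BD] by blast
qed

lemma right_conditions_inverse:
  assumes fin: "finite S" and right: "right_conditions S D lam \<alpha> \<beta> L" and inv: "lam * lam_inv = 1"
  shows "is_inverse_matrix S D (\<lambda>u v. - L u v + lam_inv * (\<beta> u * \<alpha> v))"
proof -
  have "is_inverse_matrix S (\<lambda>u v. D v u) (\<lambda>u v. - L v u + lam_inv * (\<alpha> u * \<beta> v))"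
    using right by (intro left_conditions_inverse[OF fin _ inv]) (simp add: right_conditions_transpose)
  then show ?thesis
    by (subst is_inverse_matrix_transpose[symmetric]) (simp add: mult.commute)
qed

section \<open>Combinatorics: separation by a vertex in a connected undirected graph\<close>

section \<open>Gates of maximal inseparable sets\<close>

locale connected_relation =
  fixes V :: "'v set" and E :: "('v \<times> 'v) set"
  assumes finite_V: "finite V" and E_subset: "E \<subseteq> V \<times> V" and sym_E: "sym E"
    and connected_E: "u \<in> V \<Longrightarrow> v \<in> V \<Longrightarrow> (u, v) \<in> E\<^sup>*"
begin

text \<open>The closure is reflexive at \<open>x\<close> too: \<open>x\<close> is related to itself
  and, by \<open>avoiding_from_avoided\<close>, to nothing else.\<close>

definition avoiding :: "'v \<Rightarrow> ('v \<times> 'v) set" where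
  "avoiding x = {(a, b) \<in> E. a \<noteq> x \<and> b \<noteq> x}\<^sup>*"

lemma avoiding_refl [simp]: "(a, a) \<in> avoiding x"
  by (simp add: avoiding_def)

lemma avoiding_sym: "(a, b) \<in> avoiding x \<Longrightarrow> (b, a) \<in> avoiding x"
proof -
  have "sym {(a, b) \<in> E. a \<noteq> x \<and> b \<noteq> x}"
    using sym_E by (auto simp: sym_def)
  then show "(a, b) \<in> avoiding x \<Longrightarrow> (b, a) \<in> avoiding x"
    unfolding avoiding_def by (meson sym_rtrancl symD)
qed

lemma avoiding_trans: "(a, b) \<in> avoiding x \<Longrightarrow> (b, c) \<in> avoiding x \<Longrightarrow> (a, c) \<in> avoiding x"
  unfolding avoiding_def by (rule rtrancl_trans)

lemma avoiding_step: "(a, b) \<in> E \<Longrightarrow> a \<noteq> x \<Longrightarrow> b \<noteq> x \<Longrightarrow> (a, b) \<in> avoiding x"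
  unfolding avoiding_def by auto

lemma avoiding_from_avoided: "(x, b) \<in> avoiding x \<Longrightarrow> b = x"
  unfolding avoiding_def by (erule converse_rtranclE) auto

text \<open>The connections may leave \<open>S\<close>. That they can be pulled into a maximal set
  is shown below by retraction.\<close>

definition inseparable :: "'v set \<Rightarrow> bool" where
  "inseparable S \<longleftrightarrow> S \<subseteq> V \<and> (\<forall>x. \<forall>a\<in>S - {x}. \<forall>b\<in>S - {x}. (a, b) \<in> avoiding x)"

definition maximal_inseparable :: "'v set \<Rightarrow> bool" where
  "maximal_inseparable S \<longleftrightarrow> inseparable S \<and> (\<forall>T. inseparable T \<and> S \<subseteq> T \<longrightarrow> T = S)"

definition is_gate :: "'v set \<Rightarrow> 'v \<Rightarrow> 'v \<Rightarrow> bool" where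
  "is_gate S v g \<longleftrightarrow> g \<in> S \<and> (\<forall>s\<in>S - {g}. (v, s) \<notin> avoiding g)"

definition gate :: "'v set \<Rightarrow> 'v \<Rightarrow> 'v" where
  "gate S v = (THE g. is_gate S v g)"

lemma inseparableD:
  "inseparable S \<Longrightarrow> a \<in> S \<Longrightarrow> b \<in> S \<Longrightarrow> a \<noteq> x \<Longrightarrow> b \<noteq> x \<Longrightarrow> (a, b) \<in> avoiding x"
  unfolding inseparable_def by blast

lemma inseparable_edge: "(a, b) \<in> E \<Longrightarrow> inseparable {a, b}"
  using E_subset by (auto simp: inseparable_def intro: avoiding_step avoiding_sym[OF avoiding_step])

lemma ex_maximal_inseparable:
  assumes "inseparable S"
  obtains T where "maximal_inseparable T" "S \<subseteq> T"
proof -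
  have "finite {T. inseparable T}"
    by (rule finite_subset[of _ "Pow V"]) (auto simp: inseparable_def finite_V)
  from finite_has_maximal2[OF this, of S] assms obtain T where
    "inseparable T" "S \<subseteq> T" "\<And>T'. inseparable T' \<Longrightarrow> T \<subseteq> T' \<Longrightarrow> T = T'"
    by auto
  then show thesis
    using that unfolding maximal_inseparable_def by blast
qed

lemma maximal_inseparable_subset: "maximal_inseparable S \<Longrightarrow> S \<subseteq> V"
  by (simp add: maximal_inseparable_def inseparable_def)

lemma maximal_inseparable_nonempty:
  assumes "maximal_inseparable S" "v \<in> V"
  shows "S \<noteq> {}"
proof
  assume "S = {}"
  moreover have "inseparable {v}"
    using assms by (auto simp: inseparable_def)
  ultimately show False
    using assms unfolding maximal_inseparable_def by blast
qed

text \<open>Reflexivity of \<open>avoiding g\<close> excludes every gate but \<open>v\<close>; and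
  \<open>v\<close> qualifies because an avoided vertex reaches nothing else.\<close>

lemma is_gate_member: "v \<in> S \<Longrightarrow> is_gate S v g \<longleftrightarrow> g = v"
  unfolding is_gate_def using avoiding_from_avoided[of v] avoiding_refl[of v g] by blast

text \<open>Suppose \<open>a\<close> reaches another \<open>s\<close> around \<open>g\<close>. If
  \<open>g\<close> is not \<open>b\<close>, the edge passes this on to \<open>b\<close>, against the
  choice of \<open>g\<close>; if \<open>g\<close> is \<open>b\<close>, maximality of
  \<open>S\<close> fails.\<close>

lemma is_gate_adjacent:
  assumes S: "maximal_inseparable S" and E: "(a, b) \<in> E" and a: "a \<notin> S" and g: "is_gate S b g"
  shows "is_gate S a g"
proof -
  have "(a, s) \<notin> avoiding g" if s: "s \<in> S" "s \<noteq> g" for s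
  proof
    assume as: "(a, s) \<in> avoiding g"
    have gS: "g \<in> S" and gs: "(b, s) \<notin> avoiding g"
      using g s unfolding is_gate_def by auto
    have insep: "inseparable S" using S by (simp add: maximal_inseparable_def)
    show False
    proof (cases "g = b")
      case False
      then have "(b, a) \<in> avoiding g"
        using E a gS by (metis avoiding_step avoiding_sym)
      then show False
        using as gs avoiding_trans by blast
    next
      case True
      \<comment> \<open>The edge from a to b and the connection of a to s around b attach a to S in two places, so
        a could be added to S.\<close>
      have to_S: "(a, t) \<in> avoiding x" if "t \<in> S" "t \<noteq> x" "a \<noteq> x" for t x
      proof (cases "x = b")
        case True
        then show ?thesis
          using as inseparableD[OF insep, of s t x] s that \<open>g = b\<close> avoiding_trans by blast
      next
        case False
        then show ?thesis
          using avoiding_step[OF E, of x] inseparableD[OF insep, of b t x] that \<open>g = b\<close> gS avoiding_trans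
          by blast
      qed
      have "inseparable (insert a S)"
        unfolding inseparable_def
      proof (intro conjI allI ballI)
        show "insert a S \<subseteq> V"
          using E E_subset insep by (auto simp: inseparable_def)
        show "(p, q) \<in> avoiding x" if "p \<in> insert a S - {x}" "q \<in> insert a S - {x}" for x p q
          using that to_S[of q x] avoiding_sym[OF to_S[of p x]] inseparableD[OF insep, of p q x]
          by (cases "p = a"; cases "q = a") auto
      qed
      then show False
        using S a unfolding maximal_inseparable_def by blast
    qed
  qed
  then show ?thesis
    using g unfolding is_gate_def by blast
qed

text \<open>Induction backwards along a walk from \<open>v\<close> to a member \<open>s\<close>,
  which is its own gate. Between vertices outside \<open>S\<close> an edge transports gates both
  ways, so existence and uniqueness spread together.\<close>

lemma ex1_gate:
  assumes S: "maximal_inseparable S" and v: "v \<in> V"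
  shows "\<exists>!g. is_gate S v g"
proof -
  obtain s where s: "s \<in> S" using maximal_inseparable_nonempty[OF S v] by blast
  then have "(v, s) \<in> E\<^sup>*"
    using connected_E v maximal_inseparable_subset[OF S] by blast
  then show ?thesis
  proof (induction rule: converse_rtrancl_induct)
    case base
    then show ?case using is_gate_member[OF s] by simp
  next
    case (step a b)
    show ?case
    proof (cases "a \<in> S")
      case True
      then show ?thesis using is_gate_member by simp
    next
      case False
      from step.IH obtain g where g: "is_gate S b g" and uniq: "\<And>h. is_gate S b h \<Longrightarrow> h = g"
        by blast
      have "h = g" if h: "is_gate S a h" for h
      proof (cases "b \<in> S")
        case True
        have "h = b"
        proof (rule ccontr)
          assume "h \<noteq> b"
          moreover have "h \<noteq> a" using h False by (auto simp: is_gate_def)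
          ultimately have "(a, b) \<in> avoiding h"
            using avoiding_step[OF step.hyps(1), of h] by metis
          then show False
            using h True \<open>h \<noteq> b\<close> unfolding is_gate_def by blast
        qed
        then show ?thesis using uniq is_gate_member[OF True] by simp
      next
        case False
        then show ?thesis
          using is_gate_adjacent[OF S _ False h] step.hyps sym_E uniq by (meson symD)
      qed
      then show ?thesis
        using is_gate_adjacent[OF S step.hyps(1) False g] by blast
    qed
  qed
qed

context
  fixes S
  assumes S: "maximal_inseparable S"
begin

lemma is_gate_gate: "v \<in> V \<Longrightarrow> is_gate S v (gate S v)"
  unfolding gate_def by (rule theI'[OF ex1_gate[OF S]])

lemma gate_eqI: "v \<in> V \<Longrightarrow> is_gate S v g \<Longrightarrow> gate S v = g"
  using ex1_gate[OF S] is_gate_gate by blast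

lemma gate_in: "v \<in> V \<Longrightarrow> gate S v \<in> S"
  using is_gate_gate is_gate_def by blast

lemma gate_separates: "v \<in> V \<Longrightarrow> s \<in> S \<Longrightarrow> s \<noteq> gate S v \<Longrightarrow> (v, s) \<notin> avoiding (gate S v)"
  using is_gate_gate is_gate_def by blast

lemma gate_self: "v \<in> S \<Longrightarrow> gate S v = v"
  using gate_eqI is_gate_member maximal_inseparable_subset[OF S] by blast

text \<open>The gate map collapses an edge to one vertex or, inside \<open>S\<close>, fixes it: it
  is a retraction of the graph onto \<open>S\<close>.\<close>

lemma gate_adjacent:
  assumes "(a, b) \<in> E"
  shows "gate S a = gate S b \<or> a \<in> S \<and> b \<in> S"
proof -
  have "gate S p = gate S q" if "(p, q) \<in> E" "p \<notin> S" for p q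
    using gate_eqI is_gate_adjacent[OF S that] is_gate_gate that(1) E_subset by blast
  then show ?thesis
    using assms sym_E by (metis symD)
qed

text \<open>\<open>R\<close> is left free so that directed steps can be retracted as well; this
  yields strong connectivity of the induced subgraph.\<close>

lemma gate_retraction:
  assumes "R \<subseteq> E" "(a, b) \<in> R\<^sup>*"
  shows "(gate S a, gate S b) \<in> (R \<inter> S \<times> S)\<^sup>*"
  using assms(2)
proof induction
  case (step b c)
  then have "(b, c) \<in> E" using assms(1) by blast
  from gate_adjacent[OF this] show ?case
  proof
    assume "b \<in> S \<and> c \<in> S"
    then have "(gate S b, gate S c) \<in> R \<inter> S \<times> S"
      using step.hyps(2) gate_self by simp
    then show ?thesis
      using step.IH by (rule rtrancl_into_rtrancl[rotated])
  qed (use step.IH in auto)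
qed simp

text \<open>Along a walk around \<open>x\<close> the gate changes only on edges inside
  \<open>S\<close>, whose ends are their own gates and differ from \<open>x\<close>. So detours
  around \<open>x\<close> can be kept in \<open>S\<close>.\<close>

lemma gate_retraction_avoiding:
  assumes "(a, b) \<in> avoiding x" "a \<in> S" "a \<noteq> x"
  shows "gate S b \<noteq> x \<and> (a, gate S b) \<in> {(p, q) \<in> E \<inter> S \<times> S. p \<noteq> x \<and> q \<noteq> x}\<^sup>*"
  using assms(1) unfolding avoiding_def
proof induction
  case base
  then show ?case using assms gate_self by simp
next
  case (step b c)
  then have E: "(b, c) \<in> E" and c: "c \<noteq> x" and b: "b \<noteq> x" by auto
  from gate_adjacent[OF E] show ?case
  proof
    assume "b \<in> S \<and> c \<in> S"
    then have "(gate S b, gate S c) \<in> {(p, q) \<in> E \<inter> S \<times> S. p \<noteq> x \<and> q \<noteq> x}" "gate S c \<noteq> x"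
      using E b c gate_self by simp_all
    then show ?thesis
      using step.IH by (blast intro: rtrancl_into_rtrancl)
  qed (use step.IH in auto)
qed

end

text \<open>Existence: take an edge \<open>(w, u)\<close> by which a walk from \<open>v\<close>
  enters \<open>u\<close> for the first time, and a maximal set containing it. Uniqueness: any other
  candidate \<open>T\<close> is shown to contain that set.\<close>

lemma ex1_maximal_inseparable_gate_neq:
  assumes u: "u \<in> V" and v: "v \<in> V" and neq: "u \<noteq> v"
  shows "\<exists>!S. maximal_inseparable S \<and> u \<in> S \<and> gate S v \<noteq> u"
proof -
  have gate_iff: "gate S v \<noteq> u \<longleftrightarrow> (\<exists>s\<in>S - {u}. (v, s) \<in> avoiding u)"
    if "maximal_inseparable S" "u \<in> S" for S
    using ex1_gate[OF that(1) v] is_gate_gate[OF that(1) v] that(2) unfolding is_gate_def by blast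
  have "(v, u) \<in> E\<^sup>*" using connected_E u v by blast
  \<comment> \<open>The walk has either not met \<open>u\<close> yet or already supplied an edge
    entering \<open>u\<close>; at \<open>y = u\<close> only the latter is possible.\<close>
  have "(v, y) \<in> E\<^sup>* \<Longrightarrow>
    (y \<noteq> u \<and> (v, y) \<in> avoiding u) \<or> (\<exists>w. w \<noteq> u \<and> (v, w) \<in> avoiding u \<and> (w, u) \<in> E)" for y
  proof (induction rule: rtrancl_induct)
    case base
    then show ?case using neq by simp
  next
    case (step y z)
    then show ?case using avoiding_step avoiding_trans by metis
  qed
  from this[OF \<open>(v, u) \<in> E\<^sup>*\<close>] obtain w where w: "w \<noteq> u" "(v, w) \<in> avoiding u" "(w, u) \<in> E" by blast
  obtain S where S: "maximal_inseparable S" "{w, u} \<subseteq> S"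
    using ex_maximal_inseparable[OF inseparable_edge[OF w(3)]] by blast
  show ?thesis
  proof (rule ex1I[of _ S])
    show "maximal_inseparable S \<and> u \<in> S \<and> gate S v \<noteq> u"
      using S gate_iff[OF S(1)] w by blast
  next
    fix T assume T: "maximal_inseparable T \<and> u \<in> T \<and> gate T v \<noteq> u"
    then obtain t where t: "t \<in> T" "t \<noteq> u" "(v, t) \<in> avoiding u"
      using gate_iff by blast
    \<comment> \<open>For \<open>b\<close> outside \<open>T\<close>, the gate in \<open>T\<close>
      cannot be \<open>u\<close>, since \<open>b\<close> reaches \<open>t\<close> around
      \<open>u\<close> via \<open>w\<close> and \<open>v\<close>; nor another vertex, since
      \<open>b\<close> and \<open>u\<close> are connected around it by inseparability of
      \<open>S\<close>.\<close>
    have "b \<in> T" if b: "b \<in> S" for b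
    proof (rule ccontr)
      assume "b \<notin> T"
      have bV: "b \<in> V" using b S(1) maximal_inseparable_subset by blast
      let ?g = "gate T b"
      have gT: "?g \<in> T" using T bV gate_in by blast
      have "b \<noteq> u" "b \<noteq> ?g" using \<open>b \<notin> T\<close> T gT by auto
      have insep: "inseparable S" using S(1) by (simp add: maximal_inseparable_def)
      show False
      proof (cases "?g = u")
        case True
        have "(b, w) \<in> avoiding u"
          using inseparableD[OF insep b] S(2) w(1) \<open>b \<noteq> u\<close> by blast
        then have "(b, t) \<in> avoiding u"
          using w t avoiding_sym avoiding_trans by blast
        then show False
          using gate_separates[of T b t] T bV t True by simp
      next
        case False
        then have "(b, u) \<in> avoiding ?g"
          using inseparableD[OF insep b] S(2) \<open>b \<noteq> ?g\<close> by blast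
        then show False
          using gate_separates[of T b u] T bV False by simp
      qed
    qed
    then have "S \<subseteq> T" by blast
    then show "T = S"
      using S(1) T unfolding maximal_inseparable_def by blast
  qed
qed

end

section \<open>Connectivity and cut vertices of mixed graphs in terms of relations\<close>

section \<open>Blocks of mixed graphs\<close>

definition dstep :: "'v mixed_graph \<Rightarrow> ('v \<times> 'v) set" where
  "dstep G = marcs G \<union> {(u, v). {u, v} \<in> medges G}"

definition ustep :: "'v mixed_graph \<Rightarrow> ('v \<times> 'v) set" where
  "ustep G = dstep G \<union> (dstep G)\<inverse>"

definition mixed_induced :: "'v mixed_graph \<Rightarrow> 'v set \<Rightarrow> 'v mixed_graph" where
  "mixed_induced G S = \<lparr> mverts = S, medges = {e \<in> medges G. e \<subseteq> S}, marcs = marcs G \<inter> S \<times> S \<rparr>"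

lemma verts_traversal [simp]: "verts (traversal G) = mverts G"
  and arcs_traversal: "arcs (traversal G) = dstep G"
  and tail_traversal [simp]: "tail (traversal G) = fst"
  and head_traversal [simp]: "head (traversal G) = snd"
  by (simp_all add: traversal_def dstep_def)

lemma arcs_ends_traversal: "arcs_ends (traversal G) = dstep G"
  by (auto simp: arcs_ends_def arc_to_ends_def arcs_traversal)

lemma dstep_subset: "wf_mixed_graph G \<Longrightarrow> dstep G \<subseteq> mverts G \<times> mverts G"
  unfolding wf_mixed_graph_def dstep_def by (fastforce simp: doubleton_eq_iff)

lemma ustep_subset: "wf_mixed_graph G \<Longrightarrow> ustep G \<subseteq> mverts G \<times> mverts G"
  using dstep_subset[of G] unfolding ustep_def by blast

lemma rtrancl_on_eq:
  assumes "R \<subseteq> V \<times> V" "u \<in> V" "v \<in> V"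
  shows "(u, v) \<in> rtrancl_on V R \<longleftrightarrow> (u, v) \<in> R\<^sup>*"
proof
  show "(u, v) \<in> R\<^sup>*" if "(u, v) \<in> rtrancl_on V R"
    using that by (rule rtrancl_on_rtranclI)
  show "(u, v) \<in> rtrancl_on V R" if "(u, v) \<in> R\<^sup>*"
    by (rule rtrancl_consistent_rtrancl_on[OF that assms(2,3)]) (use assms(1) in blast)
qed

lemma strongly_connected_traversal:
  assumes "wf_mixed_graph G"
  shows "strongly_connected (traversal G) \<longleftrightarrow>
    mverts G \<noteq> {} \<and> (\<forall>u\<in>mverts G. \<forall>v\<in>mverts G. (u, v) \<in> (dstep G)\<^sup>*)"
  using rtrancl_on_eq[OF dstep_subset[OF assms]]
  unfolding strongly_connected_def reachable_def arcs_ends_traversal by auto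

lemma connected_traversal:
  assumes "wf_mixed_graph G"
  shows "connected (traversal G) \<longleftrightarrow>
    mverts G \<noteq> {} \<and> (\<forall>u\<in>mverts G. \<forall>v\<in>mverts G. (u, v) \<in> (ustep G)\<^sup>*)"
proof -
  have "arcs_ends (with_proj (mk_symmetric (traversal G))) = ustep G"
    by (auto simp: arcs_ends_def arc_to_ends_def parcs_mk_symmetric arcs_traversal ustep_def)
  then show ?thesis
    using rtrancl_on_eq[OF ustep_subset[OF assms]]
    unfolding connected_def strongly_connected_def reachable_def by auto
qed

text \<open>The clause excluding the empty graph is absorbed: two unconnected vertices witness that
  something is left.\<close>

lemma cut_vertex_iff:
  assumes wf: "wf_mixed_graph G"
  shows "cut_vertex G x \<longleftrightarrow> x \<in> mverts G \<and>
    (\<exists>u\<in>mverts G - {x}. \<exists>v\<in>mverts G - {x}. (u, v) \<notin> {(a, b) \<in> ustep G. a \<noteq> x \<and> b \<noteq> x}\<^sup>*)"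
proof -
  have "wf_mixed_graph (mixed_del_vert G x)"
    using wf unfolding wf_mixed_graph_def mixed_del_vert_def by fastforce
  moreover have "ustep (mixed_del_vert G x) = {(a, b) \<in> ustep G. a \<noteq> x \<and> b \<noteq> x}"
    by (auto simp: ustep_def dstep_def mixed_del_vert_def)
  moreover have "mverts (mixed_del_vert G x) = mverts G - {x}"
    by (simp add: mixed_del_vert_def)
  ultimately show ?thesis
    using connected_traversal[of "mixed_del_vert G x"] unfolding cut_vertex_def by auto
qed

lemma mverts_mixed_induced [simp]: "mverts (mixed_induced G S) = S"
  by (simp add: mixed_induced_def)

lemma dstep_mixed_induced: "dstep (mixed_induced G S) = dstep G \<inter> S \<times> S"
  by (auto simp: dstep_def mixed_induced_def)

lemma ustep_mixed_induced: "ustep (mixed_induced G S) = ustep G \<inter> S \<times> S"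
  by (auto simp: ustep_def dstep_mixed_induced)

lemma mixed_subgraph_induced:
  assumes "wf_mixed_graph G" "S \<subseteq> mverts G"
  shows "mixed_subgraph (mixed_induced G S) G"
proof -
  have "wf_mixed_graph (mixed_induced G S)"
    unfolding wf_mixed_graph_def
  proof (intro conjI)
    show "finite (mverts (mixed_induced G S))"
      using assms finite_subset by (auto simp: wf_mixed_graph_def mixed_induced_def)
    show "medges (mixed_induced G S) \<subseteq>
        {{u, v} |u v. u \<in> mverts (mixed_induced G S) \<and> v \<in> mverts (mixed_induced G S) \<and> u \<noteq> v}"
    proof
      fix e assume "e \<in> medges (mixed_induced G S)"
      then have e: "e \<in> medges G" "e \<subseteq> S" by (simp_all add: mixed_induced_def)
      then obtain u v where "e = {u, v}" "u \<noteq> v"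
        using assms(1) unfolding wf_mixed_graph_def by blast
      then show "e \<in> {{u, v} |u v. u \<in> mverts (mixed_induced G S) \<and> v \<in> mverts (mixed_induced G S) \<and> u \<noteq> v}"
        using e by auto
    qed
    show "marcs (mixed_induced G S) \<subseteq>
        {(u, v). u \<in> mverts (mixed_induced G S) \<and> v \<in> mverts (mixed_induced G S) \<and> u \<noteq> v}"
      using assms(1) by (auto simp: wf_mixed_graph_def mixed_induced_def)
  qed
  then show ?thesis
    using assms by (auto simp: mixed_subgraph_def mixed_induced_def)
qed

text \<open>This is what forces blocks, as maximal subgraphs, to be induced.\<close>

lemma mixed_subgraph_induced_mverts:
  assumes "mixed_subgraph H G"
  shows "mixed_subgraph H (mixed_induced G (mverts H))"
proof -
  have sub: "mverts H \<subseteq> mverts G" and "wf_mixed_graph G" and wf: "wf_mixed_graph H"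
    and es: "medges H \<subseteq> medges G" "marcs H \<subseteq> marcs G"
    using assms by (auto simp: mixed_subgraph_def)
  then have "wf_mixed_graph (mixed_induced G (mverts H))"
    using mixed_subgraph_induced[of G "mverts H"] by (simp add: mixed_subgraph_def)
  moreover have "e \<subseteq> mverts H" if "e \<in> medges H" for e
    using wf that unfolding wf_mixed_graph_def by blast
  moreover have "marcs H \<subseteq> mverts H \<times> mverts H"
    using wf unfolding wf_mixed_graph_def by blast
  ultimately show ?thesis
    using wf es unfolding mixed_subgraph_def by (auto simp: mixed_induced_def)
qed

lemma mixed_subgraph_antisym:
  "mixed_subgraph H K \<Longrightarrow> mixed_subgraph K H \<Longrightarrow> H = (K :: 'v mixed_graph)"
  unfolding mixed_subgraph_def by (intro mixed_graph.equality) auto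

lemma ustep_mono: "mixed_subgraph H G \<Longrightarrow> ustep H \<subseteq> ustep G"
  unfolding ustep_def dstep_def mixed_subgraph_def by blast

section \<open>Blocks as induced subgraphs, and additivity of distances through gates\<close>

locale distance_graph =
  fixes G :: "'v mixed_graph"
  assumes dwd: "distance_well_defined G"
begin

lemma wf: "wf_mixed_graph G"
  using dwd by (simp add: distance_well_defined_def)

lemma dstep_connected: "u \<in> mverts G \<Longrightarrow> v \<in> mverts G \<Longrightarrow> (u, v) \<in> (dstep G)\<^sup>*"
  using dwd strongly_connected_traversal[OF wf] by (simp add: distance_well_defined_def)

sublocale connected_relation "mverts G" "ustep G"
proof
  show "finite (mverts G)" using wf by (simp add: wf_mixed_graph_def)
  show "ustep G \<subseteq> mverts G \<times> mverts G" by (rule ustep_subset[OF wf])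
  show "sym (ustep G)" by (auto simp: ustep_def sym_def)
  have "(dstep G)\<^sup>* \<subseteq> (ustep G)\<^sup>*" by (rule rtrancl_mono) (simp add: ustep_def)
  then show "(u, v) \<in> (ustep G)\<^sup>*" if "u \<in> mverts G" "v \<in> mverts G" for u v
    using dstep_connected that by blast
qed

lemma cut_vertex_iff_avoiding: "cut_vertex G x \<longleftrightarrow> x \<in> mverts G \<and>
    (\<exists>u\<in>mverts G - {x}. \<exists>v\<in>mverts G - {x}. (u, v) \<notin> avoiding x)"
  unfolding avoiding_def by (rule cut_vertex_iff[OF wf])

text \<open>A vertex inside \<open>H\<close> is not a cut vertex of \<open>H\<close>; a vertex
  outside is avoided by every walk in \<open>H\<close>.\<close>

lemma nonseparable_imp_inseparable:
  assumes H: "nonseparable_subgraph G H"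
  shows "inseparable (mverts H)"
proof -
  have sub: "mixed_subgraph H G" and wfH: "wf_mixed_graph H" and no_cut: "\<not> cut_vertex H x"
    and conn: "\<And>u v. u \<in> mverts H \<Longrightarrow> v \<in> mverts H \<Longrightarrow> (u, v) \<in> (dstep H)\<^sup>*" for x
    using H strongly_connected_traversal[of H]
    by (auto simp: nonseparable_subgraph_def distance_well_defined_def)
  have mono: "{(a, b) \<in> ustep H. a \<noteq> x \<and> b \<noteq> x}\<^sup>* \<subseteq> avoiding x" for x
    unfolding avoiding_def using ustep_mono[OF sub] by (intro rtrancl_mono) auto
  have "(a, b) \<in> avoiding x" if ab: "a \<in> mverts H - {x}" "b \<in> mverts H - {x}" for a b x
  proof (cases "x \<in> mverts H")
    case True
    then show ?thesis
      using no_cut cut_vertex_iff[OF wfH, of x] ab mono[of x] by blast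
  next
    case False
    then have "dstep H \<subseteq> {(a, b) \<in> ustep H. a \<noteq> x \<and> b \<noteq> x}"
      using dstep_subset[OF wfH] by (auto simp: ustep_def)
    then show ?thesis
      using conn[of a b] ab mono[of x] rtrancl_mono by blast
  qed
  then show ?thesis
    using sub by (simp add: inseparable_def mixed_subgraph_def)
qed

text \<open>A singleton \<open>{u}\<close> is not maximal: for a second vertex \<open>w\<close>, the
  maximal set at \<open>u\<close> leading towards \<open>w\<close> also contains a gate other than
  \<open>u\<close>.\<close>

lemma card_maximal_inseparable:
  assumes S: "maximal_inseparable S" and card: "card (mverts G) \<ge> 2"
  shows "card S \<ge> 2"
proof -
  obtain v where "v \<in> mverts G" using card by fastforce
  then obtain u where u: "u \<in> S" "u \<in> mverts G"
    using maximal_inseparable_nonempty[OF S] maximal_inseparable_subset[OF S] by blast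
  have "mverts G \<noteq> {u}" using card by auto
  then obtain w where w: "w \<in> mverts G" "u \<noteq> w" using u by blast
  show ?thesis
  proof (cases "S = {u}")
    case True
    obtain T where T: "maximal_inseparable T" "u \<in> T" "gate T w \<noteq> u"
      using ex1_maximal_inseparable_gate_neq[OF u(2) w] by blast
    then have "T = S"
      using S True unfolding maximal_inseparable_def by blast
    then show ?thesis
      using gate_in[OF T(1) w(1)] T True by simp
  next
    case False
    then obtain s where "s \<in> S" "s \<noteq> u" using u by blast
    then have "card {u, s} \<le> card S"
      using u finite_subset[OF maximal_inseparable_subset[OF S] finite_V] by (intro card_mono) auto
    then show ?thesis using \<open>s \<noteq> u\<close> by simp
  qed
qed

text \<open>Directed walks of \<open>G\<close>, and detours around a vertex, both retract into
  \<open>S\<close>: the former give strong connectivity, the latter exclude cut vertices.\<close>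

lemma nonseparable_induced:
  assumes S: "maximal_inseparable S" and card: "card (mverts G) \<ge> 2"
  shows "nonseparable_subgraph G (mixed_induced G S)"
proof -
  let ?H = "mixed_induced G S"
  have SV: "S \<subseteq> mverts G" by (rule maximal_inseparable_subset[OF S])
  have sub: "mixed_subgraph ?H G" by (rule mixed_subgraph_induced[OF wf SV])
  then have wfH: "wf_mixed_graph ?H" by (simp add: mixed_subgraph_def)
  have card_S: "card S \<ge> 2" by (rule card_maximal_inseparable[OF S card])
  have "(u, v) \<in> (dstep ?H)\<^sup>*" if "u \<in> S" "v \<in> S" for u v
    using gate_retraction[OF S _ dstep_connected, of u v] that SV gate_self[OF S]
    by (auto simp: dstep_mixed_induced ustep_def)
  moreover have "S \<noteq> {}" using card_S by auto
  ultimately have "distance_well_defined ?H"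
    using wfH strongly_connected_traversal[OF wfH] by (simp add: distance_well_defined_def)
  moreover have "\<not> cut_vertex ?H x" for x
  proof -
    have "(u, v) \<in> {(a, b) \<in> ustep ?H. a \<noteq> x \<and> b \<noteq> x}\<^sup>*" if "u \<in> S - {x}" "v \<in> S - {x}" for u v
    proof -
      have "(u, v) \<in> avoiding x"
        using that S inseparableD unfolding maximal_inseparable_def by blast
      then show ?thesis
        using gate_retraction_avoiding[OF S, of u v x] that gate_self[OF S, of v]
        by (simp add: ustep_mixed_induced)
    qed
    then show ?thesis
      unfolding cut_vertex_iff[OF wfH] by simp
  qed
  ultimately show ?thesis
    using sub card_S by (simp add: nonseparable_subgraph_def)
qed

text \<open>A block lies in the nonseparable subgraph induced by some maximal set, hence equals it.
  Conversely, a nonseparable subgraph above an induced one has the same vertices, hence no further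
  edges or arcs. A one-vertex graph has a maximal set but no block, whence the size
  condition.\<close>

lemma blocks_eq:
  assumes card: "card (mverts G) \<ge> 2"
  shows "blocks G = mixed_induced G ` {S. maximal_inseparable S}"
proof (intro equalityI subsetI)
  fix H assume H: "H \<in> blocks G"
  then have ns: "nonseparable_subgraph G H"
    and max: "\<And>H'. nonseparable_subgraph G H' \<Longrightarrow> mixed_subgraph H H' \<Longrightarrow> H' = H"
    by (auto simp: blocks_def)
  obtain S where S: "maximal_inseparable S" "mverts H \<subseteq> S"
    using ex_maximal_inseparable[OF nonseparable_imp_inseparable[OF ns]] .
  have ns': "nonseparable_subgraph G (mixed_induced G S)"
    by (rule nonseparable_induced[OF S(1) card])
  have "mixed_subgraph H G" using ns by (simp add: nonseparable_subgraph_def)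
  then have "mixed_subgraph H (mixed_induced G S)"
    using mixed_subgraph_induced_mverts[of H G] ns' S(2)
    by (auto simp: mixed_subgraph_def nonseparable_subgraph_def mixed_induced_def)
  then have "mixed_induced G S = H"
    by (rule max[OF ns'])
  then show "H \<in> mixed_induced G ` {S. maximal_inseparable S}"
    using S(1) by blast
next
  fix H assume "H \<in> mixed_induced G ` {S. maximal_inseparable S}"
  then obtain S where S: "maximal_inseparable S" and H: "H = mixed_induced G S" by blast
  have "H' = H" if ns: "nonseparable_subgraph G H'" and sub: "mixed_subgraph H H'" for H'
  proof -
    have "S \<subseteq> mverts H'" using sub by (simp add: H mixed_subgraph_def)
    then have "mverts H' = S"
      using S nonseparable_imp_inseparable[OF ns] unfolding maximal_inseparable_def by blast
    then have "mixed_subgraph H' H"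
      using ns mixed_subgraph_induced_mverts[of H' G] by (simp add: H nonseparable_subgraph_def)
    then show ?thesis using sub mixed_subgraph_antisym by blast
  qed
  then show "H \<in> blocks G"
    using nonseparable_induced[OF S card] by (simp add: blocks_def H)
qed

text \<open>Used in contrapositive: a vertex separating \<open>u\<close> from \<open>v\<close> lies
  on every walk between them.\<close>

lemma walk_avoiding:
  assumes "pre_digraph.awalk (traversal G) u p v" "x \<notin> set (pre_digraph.awalk_verts (traversal G) u p)"
  shows "(u, v) \<in> avoiding x"
  using assms
proof (induction p arbitrary: u)
  case Nil
  then show ?case by (simp add: pre_digraph.awalk_def pre_digraph.cas.simps)
next
  case (Cons e p)
  obtain w where e: "e = (u, w)" and edge: "(u, w) \<in> dstep G"
    and p: "pre_digraph.cas (traversal G) w p v" "set p \<subseteq> dstep G"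
    using Cons.prems(1)
    by (cases e) (auto simp: pre_digraph.awalk_def pre_digraph.cas.simps arcs_traversal)
  then have "pre_digraph.awalk (traversal G) w p v"
    using dstep_subset[OF wf] by (auto simp: pre_digraph.awalk_def arcs_traversal)
  moreover have x: "u \<noteq> x" "x \<notin> set (pre_digraph.awalk_verts (traversal G) w p)"
    using Cons.prems(2) by (auto simp: e pre_digraph.awalk_verts.simps)
  ultimately have "(w, v) \<in> avoiding x"
    by (intro Cons.IH)
  moreover have "w \<noteq> x"
    using x(2) by (cases p) (use p(1) in \<open>auto simp: pre_digraph.awalk_verts.simps pre_digraph.cas.simps\<close>)
  then have "(u, w) \<in> avoiding x"
    using x(1) edge by (intro avoiding_step) (auto simp: ustep_def)
  ultimately show ?case by (blast intro: avoiding_trans)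
qed

text \<open>If the gate is \<open>u\<close> or \<open>v\<close>, the zero diagonal suffices.
  Otherwise it is a cut vertex on all shortest paths in both directions. The second equation serves
  the transposed problem.\<close>

lemma generalized_distance_gate:
  assumes D: "generalized_distance_matrix G D" and S: "maximal_inseparable S"
    and u: "u \<in> S" and v: "v \<in> mverts G"
  shows "D u v = D u (gate S v) + D (gate S v) v" "D v u = D v (gate S v) + D (gate S v) u"
proof -
  let ?g = "gate S v"
  have uV: "u \<in> mverts G" and gV: "?g \<in> mverts G"
    using u gate_in[OF S v] maximal_inseparable_subset[OF S] by auto
  then have Dg: "D ?g ?g = 0"
    using D by (simp add: generalized_distance_matrix_def)
  have "D u v = D u ?g + D ?g v \<and> D v u = D v ?g + D ?g u"
  proof (cases "u = ?g \<or> v = ?g")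
    case True
    then show ?thesis using Dg by auto
  next
    case False
    then have sep: "(v, u) \<notin> avoiding ?g" "(u, v) \<notin> avoiding ?g"
      using gate_separates[OF S v u] avoiding_sym by blast+
    then have cut: "cut_vertex G ?g"
      using False uV v gV unfolding cut_vertex_iff_avoiding by blast
    have "?g \<in> set (pre_digraph.awalk_verts (traversal G) a p)"
      if "(a, b) \<notin> avoiding ?g" "shortest_path G a p b" for a b p
      using walk_avoiding[of a p b ?g] that by (auto simp: shortest_path_def pre_digraph.apath_def)
    then show ?thesis
      using D cut sep uV v unfolding generalized_distance_matrix_def by blast
  qed
  then show "D u v = D u ?g + D ?g v" "D v u = D v ?g + D ?g u" by simp_all
qed

text \<open>Uniqueness was proved for vertex sets, while blocks are numbered; as induced subgraphs
  they are determined by their vertex sets, so uniqueness passes to indices.\<close>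

lemma gated_family_blocks:
  fixes r :: nat
  assumes r: "r \<ge> 1" and bij: "bij_betw Gs {1..r} (blocks G)"
  shows "gated_family (mverts G) {1..r} (\<lambda>i. mverts (Gs i)) (\<lambda>i. gate (mverts (Gs i)))"
    and "i \<in> {1..r} \<Longrightarrow> maximal_inseparable (mverts (Gs i))"
proof -
  \<comment> \<open>Since \<open>r \<ge> 1\<close>, there is a block, which supplies the two
    vertices that \<open>blocks_eq\<close> asks for.\<close>
  have "Gs 1 \<in> blocks G" using bij_betwE[OF bij] r by simp
  then have "2 \<le> card (mverts (Gs 1))" "mverts (Gs 1) \<subseteq> mverts G"
    by (auto simp: blocks_def nonseparable_subgraph_def mixed_subgraph_def)
  then have card: "card (mverts G) \<ge> 2"
    using card_mono[OF finite_V] by (meson le_trans)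
  note blocks = blocks_eq[OF card]
  show max: "maximal_inseparable (mverts (Gs i))" if "i \<in> {1..r}" for i
    using bij_betwE[OF bij] that unfolding blocks by fastforce
  have ex_i: "\<exists>i\<in>{1..r}. mverts (Gs i) = S" if "maximal_inseparable S" for S
  proof -
    have "mixed_induced G S \<in> Gs ` {1..r}"
      using bij that unfolding blocks bij_betw_def by blast
    then show ?thesis by (metis imageE mverts_mixed_induced)
  qed
  have inj: "i = j" if ij: "i \<in> {1..r}" "j \<in> {1..r}" and eq: "mverts (Gs i) = mverts (Gs j)" for i j
  proof -
    have "Gs k = mixed_induced G (mverts (Gs k))" if "k \<in> {1..r}" for k
      using bij_betwE[OF bij] that unfolding blocks by fastforce
    from this[OF ij(1)] this[OF ij(2)] have "Gs i = Gs j" using eq by simp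
    then show ?thesis by (rule inj_onD[OF bij_betw_imp_inj_on[OF bij] _ ij])
  qed
  show "gated_family (mverts G) {1..r} (\<lambda>i. mverts (Gs i)) (\<lambda>i. gate (mverts (Gs i)))"
  proof
    show "mverts G \<noteq> {}" using card by auto
    show "mverts (Gs i) \<subseteq> mverts G" if "i \<in> {1..r}" for i
      by (rule maximal_inseparable_subset[OF max[OF that]])
    show "gate (mverts (Gs i)) v \<in> mverts (Gs i)" if "i \<in> {1..r}" "v \<in> mverts G" for i v
      by (rule gate_in[OF max[OF that(1)] that(2)])
    show "gate (mverts (Gs i)) v = v" if "i \<in> {1..r}" "v \<in> mverts (Gs i)" for i v
      by (rule gate_self[OF max[OF that(1)] that(2)])
    show "\<exists>!i. i \<in> {1..r} \<and> u \<in> mverts (Gs i) \<and> gate (mverts (Gs i)) v \<noteq> u"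
      if uv: "u \<in> mverts G" "v \<in> mverts G" "u \<noteq> v" for u v
    proof -
      from ex1_maximal_inseparable_gate_neq[OF uv] obtain S where
        S: "maximal_inseparable S" "u \<in> S" "gate S v \<noteq> u"
        and uniq: "\<And>T. maximal_inseparable T \<Longrightarrow> u \<in> T \<Longrightarrow> gate T v \<noteq> u \<Longrightarrow> T = S"
        by (elim ex1E) blast
      from ex_i[OF S(1)] obtain i where i: "i \<in> {1..r}" "mverts (Gs i) = S" by blast
      show ?thesis
      proof (rule ex1I[of _ i])
        show "i \<in> {1..r} \<and> u \<in> mverts (Gs i) \<and> gate (mverts (Gs i)) v \<noteq> u"
          using i S by simp
        show "j = i" if "j \<in> {1..r} \<and> u \<in> mverts (Gs j) \<and> gate (mverts (Gs j)) v \<noteq> u" for j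
        proof -
          have "mverts (Gs j) = S"
            using that by (intro uniq max) auto
          then show ?thesis
            using that i by (intro inj) auto
        qed
      qed
    qed
  qed (simp_all add: finite_V)
qed

end

theorem theorem3p3:
  fixes G :: "'v mixed_graph"
    and Gs :: "nat \<Rightarrow> 'v mixed_graph"
    and r :: nat
    and D :: "'v \<Rightarrow> 'v \<Rightarrow> 'r :: comm_ring_1"
    and lams :: "nat \<Rightarrow> 'r"
    and \<alpha>s \<beta>s :: "nat \<Rightarrow> 'v \<Rightarrow> 'r"
    and Ls :: "nat \<Rightarrow> 'v \<Rightarrow> 'v \<Rightarrow> 'r"
    and lam :: 'r
    and \<alpha> \<beta> :: "'v \<Rightarrow> 'r"
    and L :: "'v \<Rightarrow> 'v \<Rightarrow> 'r"
  assumes "distance_well_defined G"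
    and "r \<ge> 1"
    and "bij_betw Gs {1..r} (blocks G)"
    and "generalized_distance_matrix G D"
    and "lam = (\<Sum>i = 1..r. lams i)"
    and "\<And>v. v \<in> mverts G \<Longrightarrow> \<alpha> v = combine_vectors r Gs \<alpha>s v"
    and "\<And>v. v \<in> mverts G \<Longrightarrow> \<beta> v = combine_vectors r Gs \<beta>s v"
    and "\<And>u v. u \<in> mverts G \<Longrightarrow> v \<in> mverts G \<Longrightarrow> L u v = combine_matrices r Gs Ls u v"
  shows "((\<forall>i\<in>{1..r}. left_conditions (mverts (Gs i)) D (lams i) (\<alpha>s i) (\<beta>s i) (Ls i)) \<longrightarrow>
            left_conditions (mverts G) D lam \<alpha> \<beta> L) \<and>
         ((\<forall>i\<in>{1..r}. right_conditions (mverts (Gs i)) D (lams i) (\<alpha>s i) (\<beta>s i) (Ls i)) \<longrightarrow>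
            right_conditions (mverts G) D lam \<alpha> \<beta> L) \<and>
         ((\<forall>i\<in>{1..r}. left_conditions (mverts (Gs i)) D (lams i) (\<alpha>s i) (\<beta>s i) (Ls i)) \<or>
          (\<forall>i\<in>{1..r}. right_conditions (mverts (Gs i)) D (lams i) (\<alpha>s i) (\<beta>s i) (Ls i)) \<longrightarrow>
            (\<forall>lam_inv. lam * lam_inv = 1 \<longrightarrow>
               is_inverse_matrix (mverts G) D (\<lambda>u v. - L u v + lam_inv * (\<beta> u * \<alpha> v))))"
proof -
  interpret distance_graph G using assms(1) by unfold_locales
  interpret gated_family "mverts G" "{1..r}" "\<lambda>i. mverts (Gs i)" "\<lambda>i. gate (mverts (Gs i))"
    by (rule gated_family_blocks(1)[OF assms(2,3)])
  have diag: "D v v = 0" if "v \<in> mverts G" for v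
    using assms(4) that by (simp add: generalized_distance_matrix_def)
  note D_gate = generalized_distance_gate[OF assms(4) gated_family_blocks(2)[OF assms(2,3)]]
  have left: "left_conditions (mverts G) D lam \<alpha> \<beta> L"
    if "\<forall>i\<in>{1..r}. left_conditions (mverts (Gs i)) D (lams i) (\<alpha>s i) (\<beta>s i) (Ls i)"
    unfolding assms(5)
    by (rule left_conditions_combine[where \<alpha>s = \<alpha>s and \<beta>s = \<beta>s and Ls = Ls])
      (use that assms(6-8) diag in \<open>simp_all add: combine_vectors_def combine_matrices_def block_indices_def D_gate(1)\<close>)
  \<comment> \<open>The transposed instance: \<open>\<alpha>s\<close> and \<open>\<beta>s\<close>
    trade places, each \<open>Ls i\<close> is transposed, and \<open>D_gate(2)\<close> is additivity
    for the transpose of \<open>D\<close>.\<close>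
  have right: "right_conditions (mverts G) D lam \<alpha> \<beta> L"
    if "\<forall>i\<in>{1..r}. right_conditions (mverts (Gs i)) D (lams i) (\<alpha>s i) (\<beta>s i) (Ls i)"
    unfolding assms(5) right_conditions_transpose
    by (rule left_conditions_combine[where \<alpha>s = \<beta>s and \<beta>s = \<alpha>s and Ls = "\<lambda>i u v. Ls i v u"])
      (use that assms(6-8) diag in \<open>simp_all add: combine_vectors_def combine_matrices_def block_indices_def
        right_conditions_transpose conj_commute D_gate(2) add.commute\<close>)
  show ?thesis
    using left right left_conditions_inverse[OF finite_V] right_conditions_inverse[OF finite_V] by blast
qed

end
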